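(* Let $a\in\mathbb{R}_+^N$ and let $b:\mathbb{R}_+^N\times\mathbb{R}_+^N\to\mathbb{R}_+^N$ be a bilinear form such that $e=a+b(e,e)$. Let $x>0$ (all entries strictly positive) be a solution of the quadratic vector equation $x=a+b(x,x)$, and assume that the matrix $R=b(e,\cdot)+b(\cdot,e)$ is irreducible. Then the matrix $$F'_x:=I-b(x,\cdot)-b(\cdot,x)$$ is an M-matrix if and only if $x$ is the minimal nonnegative solution of the equation.
   Context: $\mathbb{R}_+^N=\{v\in\mathbb{R}^N: v_i\ge 0,\ i=1,\dots,N\}$; $e=(1,1,\dots,1)^T$. Vector inequalities are componentwise. A bilinear form $b:\mathbb{R}_+^N\times\mathbb{R}_+^N\to\mathbb{R}_+^N$ is given by nonnegative coefficients $b_{ijk}=e_i^Tb(e_j,e_k)\ge0$ (with $e_\ell$ the $\ell$-th canonical basis vector) via $(b(x,y))_i=\sum_{j,k}b_{ijk}x_jy_k$; it need not be symmetric. For fixed $y,z$, $b(y,\cdot)$ and $b(\cdot,z)$ denote the $N\times N$ matrices of the linear maps $v\mapsto b(y,v)$ and $v\mapsto b(v,z)$. The matrix $F'_x$ is the Jacobian at $x$ of the map $F(x)=x-a-b(x,x)$. An M-matrix is a matrix of the form $sI-B$ with $B$ entrywise nonnegative and $s\ge\rho(B)$, where $\rho$ is the spectral radius; it may be singular ($s=\rho(B)$) or nonsingular ($s>\rho(B)$). The minimal nonnegative solution of the equation $x=a+b(x,x)$ is the nonnegative solution that is componentwise less than or equal to every other nonnegative solution; it is known to exist in this setting. *)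

theory Defs
  imports "HOL-Analysis.Analysis" "Jordan_Normal_Form.Spectral_Radius"
begin

no_notation inner (infix "\<bullet>" 70)
no_notation vec_nth (infixl "$" 90)

text \<open>Vectors are elements of \<open>carrier_vec N\<close> (indices \<open>0, \<dots>, N - 1\<close>); the order on vectors and
  matrices is the componentwise one of \<open>Jordan_Normal_Form.Matrix\<close>. A bilinear form is
  represented by its coefficients, \<open>b i j k\<close> being the \<open>i\<close>-th entry of \<open>b(e\<^sub>j, e\<^sub>k)\<close>; only the
  values at indices below \<open>N\<close> matter.\<close>

definition bil :: "nat \<Rightarrow> (nat \<Rightarrow> nat \<Rightarrow> nat \<Rightarrow> real) \<Rightarrow> real vec \<Rightarrow> real vec \<Rightarrow> real vec" where
  "bil N b x y = vec N (\<lambda>i. \<Sum>j<N. \<Sum>k<N. b i j k * x $ j * y $ k)"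

definition ones_vec :: "nat \<Rightarrow> real vec" where
  "ones_vec N = vec N (\<lambda>_. 1)"

text \<open>The matrices \<open>b(y, \<cdot>)\<close> and \<open>b(\<cdot>, z)\<close> of the two partial maps: column \<open>k\<close> is the image of the
  \<open>k\<close>-th canonical basis vector.\<close>

definition bil_left :: "nat \<Rightarrow> (nat \<Rightarrow> nat \<Rightarrow> nat \<Rightarrow> real) \<Rightarrow> real vec \<Rightarrow> real mat" where
  "bil_left N b y = mat N N (\<lambda>(i, k). bil N b y (unit_vec N k) $ i)"

definition bil_right :: "nat \<Rightarrow> (nat \<Rightarrow> nat \<Rightarrow> nat \<Rightarrow> real) \<Rightarrow> real vec \<Rightarrow> real mat" where
  "bil_right N b z = mat N N (\<lambda>(i, k). bil N b (unit_vec N k) z $ i)"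

definition qve_solution ::
  "nat \<Rightarrow> real vec \<Rightarrow> (nat \<Rightarrow> nat \<Rightarrow> nat \<Rightarrow> real) \<Rightarrow> real vec \<Rightarrow> bool" where
  "qve_solution N a b x \<longleftrightarrow> x \<in> carrier_vec N \<and> x = a + bil N b x x"

definition minimal_nonneg_solution ::
  "nat \<Rightarrow> real vec \<Rightarrow> (nat \<Rightarrow> nat \<Rightarrow> nat \<Rightarrow> real) \<Rightarrow> real vec \<Rightarrow> bool" where
  "minimal_nonneg_solution N a b x \<longleftrightarrow>
     qve_solution N a b x \<and> 0\<^sub>v N \<le> x \<and>
     (\<forall>y. qve_solution N a b y \<and> 0\<^sub>v N \<le> y \<longrightarrow> x \<le> y)"

text \<open>\<open>F'\<^sub>x\<close>, the Jacobian at \<open>x\<close> of \<open>F(x) = x - a - b(x, x)\<close>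
  (see \<open>has_partial_derivative_qve_jacobian\<close> below).\<close>

definition qve_jacobian :: "nat \<Rightarrow> (nat \<Rightarrow> nat \<Rightarrow> nat \<Rightarrow> real) \<Rightarrow> real vec \<Rightarrow> real mat" where
  "qve_jacobian N b x = 1\<^sub>m N - bil_left N b x - bil_right N b x"

text \<open>\<open>spectral_radius\<close> is defined for complex matrices, as the largest modulus of a complex
  eigenvalue; it is meaningful for square matrices of positive dimension.\<close>

definition M_matrix :: "nat \<Rightarrow> real mat \<Rightarrow> bool" where
  "M_matrix N A \<longleftrightarrow>
     (\<exists>s B. B \<in> carrier_mat N N \<and> 0\<^sub>m N N \<le> B \<and> A = s \<cdot>\<^sub>m 1\<^sub>m N - B \<and>
            spectral_radius (map_mat complex_of_real B) \<le> s)"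

text \<open>Reducible: after a simultaneous permutation of rows and columns the matrix is block
  triangular with square nonempty diagonal blocks, i.e. the entries with row in \<open>I\<close> and column
  outside \<open>I\<close> vanish for some nonempty proper index set \<open>I\<close>. All \<open>1 \<times> 1\<close> matrices, including
  the zero one, are irreducible.\<close>

definition irreducible_matrix :: "nat \<Rightarrow> real mat \<Rightarrow> bool" where
  "irreducible_matrix N A \<longleftrightarrow> A \<in> carrier_mat N N \<and>
     \<not> (\<exists>I. I \<noteq> {} \<and> I \<subset> {..<N} \<and> (\<forall>i\<in>I. \<forall>j\<in>{..<N} - I. A $$ (i, j) = 0))"

lemma sum_unit_vec:
  "l < N \<Longrightarrow> (\<Sum>k<N. f k * unit_vec N l $ k) = (f l :: real)"
proof -
  assume l: "l < N"
  have "(\<Sum>k<N. f k * unit_vec N l $ k) = (\<Sum>k<N. if k = l then f k else 0)"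
    using l by (intro sum.cong refl) (auto simp: unit_vec_def)
  thus ?thesis using l by simp
qed

lemma bil_left_index:
  assumes "i < N" "l < N"
  shows "bil_left N b y $$ (i, l) = (\<Sum>j<N. b i j l * y $ j)"
  using assms by (simp add: bil_left_def bil_def sum_unit_vec del: index_unit_vec)

lemma bil_right_index:
  assumes "i < N" "l < N"
  shows "bil_right N b z $$ (i, l) = (\<Sum>k<N. b i l k * z $ k)"
proof -
  have "bil_right N b z $$ (i, l) = (\<Sum>j<N. \<Sum>k<N. b i j k * unit_vec N l $ j * z $ k)"
    using assms by (simp add: bil_right_def bil_def del: index_unit_vec)
  also have "\<dots> = (\<Sum>j<N. (\<Sum>k<N. b i j k * z $ k) * unit_vec N l $ j)"
    by (intro sum.cong refl) (simp add: sum_distrib_left ac_simps del: index_unit_vec)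
  also have "\<dots> = (\<Sum>k<N. b i l k * z $ k)"
    using assms(2) by (rule sum_unit_vec)
  finally show ?thesis .
qed

lemma bil_left_mult:
  assumes "v \<in> carrier_vec N"
  shows "bil_left N b y *\<^sub>v v = bil N b y v"
proof (rule eq_vecI)
  show "dim_vec (bil_left N b y *\<^sub>v v) = dim_vec (bil N b y v)"
    by (simp add: bil_left_def bil_def)
  fix i assume "i < dim_vec (bil N b y v)"
  hence i: "i < N" by (simp add: bil_def)
  have d: "bil_left N b y \<in> carrier_mat N N" by (simp add: bil_left_def)
  have "(bil_left N b y *\<^sub>v v) $ i = (\<Sum>k<N. bil_left N b y $$ (i, k) * v $ k)"
    using i assms d by (simp add: scalar_prod_def atLeast0LessThan)
  also have "\<dots> = (\<Sum>k<N. \<Sum>j<N. b i j k * y $ j * v $ k)"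
    using i by (intro sum.cong refl) (simp add: bil_left_index sum_distrib_right)
  also have "\<dots> = (\<Sum>j<N. \<Sum>k<N. b i j k * y $ j * v $ k)"
    by (rule sum.swap)
  finally show "(bil_left N b y *\<^sub>v v) $ i = bil N b y v $ i"
    using i by (simp add: bil_def)
qed

lemma bil_right_mult:
  assumes "v \<in> carrier_vec N"
  shows "bil_right N b z *\<^sub>v v = bil N b v z"
proof (rule eq_vecI)
  show "dim_vec (bil_right N b z *\<^sub>v v) = dim_vec (bil N b v z)"
    by (simp add: bil_right_def bil_def)
  fix i assume "i < dim_vec (bil N b v z)"
  hence i: "i < N" by (simp add: bil_def)
  have d: "bil_right N b z \<in> carrier_mat N N" by (simp add: bil_right_def)
  have "(bil_right N b z *\<^sub>v v) $ i = (\<Sum>j<N. bil_right N b z $$ (i, j) * v $ j)"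
    using i assms d by (simp add: scalar_prod_def atLeast0LessThan)
  also have "\<dots> = (\<Sum>j<N. \<Sum>k<N. b i j k * v $ j * z $ k)"
    using i by (intro sum.cong refl) (simp add: bil_right_index sum_distrib_left ac_simps)
  finally show "(bil_right N b z *\<^sub>v v) $ i = bil N b v z $ i"
    using i by (simp add: bil_def)
qed

lemma has_partial_derivative_qve_jacobian:
  assumes "a \<in> carrier_vec N" "x \<in> carrier_vec N" "i < N" "l < N"
  shows "((\<lambda>t. (let y = x + t \<cdot>\<^sub>v unit_vec N l in y - a - bil N b y y) $ i)
           has_real_derivative qve_jacobian N b x $$ (i, l)) (at 0)"
proof -
  define u :: "nat \<Rightarrow> real" where "u j = unit_vec N l $ j" for j
  have F: "(let y = x + t \<cdot>\<^sub>v unit_vec N l in y - a - bil N b y y) $ i =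
        (x $ i + t * u i) - a $ i -
        (\<Sum>j<N. \<Sum>k<N. b i j k * ((x $ j + t * u j) * (x $ k + t * u k)))" for t
    using assms by (simp add: Let_def bil_def mult.assoc u_def del: index_unit_vec(1))
  have R: "bil_right N b x $$ (i, l) = (\<Sum>j<N. \<Sum>k<N. b i j k * (u j * x $ k))"
    using assms by (simp add: bil_right_def bil_def mult.assoc u_def del: index_unit_vec(1))
  have L: "bil_left N b x $$ (i, l) = (\<Sum>j<N. \<Sum>k<N. b i j k * (x $ j * u k))"
    using assms by (simp add: bil_left_def bil_def mult.assoc u_def del: index_unit_vec(1))
  have "qve_jacobian N b x $$ (i, l) = u i - bil_left N b x $$ (i, l) - bil_right N b x $$ (i, l)"
    using assms
    by (simp add: qve_jacobian_def bil_left_def bil_right_def u_def unit_vec_def)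
  hence J: "qve_jacobian N b x $$ (i, l) =
        u i - (\<Sum>j<N. \<Sum>k<N. b i j k * (x $ j * u k + u j * x $ k))"
    unfolding L R by (simp add: sum.distrib distrib_left)
  have q: "((\<lambda>t. b i j k * ((x $ j + t * u j) * (x $ k + t * u k)))
      has_real_derivative b i j k * (x $ j * u k + u j * x $ k)) (at 0)" for j k
    by (auto intro!: derivative_eq_intros)
  have p: "((\<lambda>t. (x $ i + t * u i) - a $ i) has_real_derivative u i) (at 0)"
    by (auto intro!: derivative_eq_intros)
  show ?thesis
    unfolding F J by (intro DERIV_diff p DERIV_sum q)
qed

end

theory Submission
  imports Defs
begin

text \<open>Write \<open>P = b(x, \<cdot>) + b(\<cdot>, x)\<close>, so that \<open>F'\<^sub>x = I - P\<close> with \<open>P \<ge> 0\<close>. The theorem compares two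
  statements about \<open>x\<close> through a third one, \<open>\<rho>(P) \<le> 1\<close>.

  Everything about \<open>\<rho>\<close> comes from one description of the spectral radius of a nonnegative matrix
  \<open>A\<close>: it is the largest \<open>c\<close> for which \<open>c v \<le> A v\<close> holds for some nonzero \<open>v \<ge> 0\<close>. That \<open>\<rho>(A)\<close> is
  such a \<open>c\<close> is seen by taking moduli in a complex eigenvector (\<open>ex_nonneg_superinvariant_vec\<close>);
  that no larger \<open>c\<close> is possible follows since \<open>A\<^sup>k v \<ge> c\<^sup>k v\<close> cannot grow faster than \<open>\<rho>(A)\<close>
  permits (\<open>superinvariant_le_spectral_radius\<close>). Since
  shifting \<open>A\<close> by a multiple of the identity shifts these inequalities, the
  choice of \<open>s\<close> in the representation \<open>s I - B\<close> of an M-matrix is immaterial, and \<open>I - P\<close> is an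
  M-matrix exactly if \<open>\<rho>(P) \<le> 1\<close> (\<open>M_matrix_one_minus_iff\<close>).

  The link with the equation is the exact expansion
  \<open>F(x - d) = P d - d - b(d, d)\<close> at a solution \<open>x\<close> (\<open>qve_defect\<close>).

  If \<open>\<rho>(P) > 1\<close>, take \<open>v \<ge> 0\<close> nonzero with \<open>P v \<ge> \<rho>(P) v\<close>. For small \<open>t > 0\<close> the expansion shows that
  \<open>x - t v\<close> is a nonnegative supersolution, that is \<open>F(x - t v) \<ge> 0\<close>. Below every nonnegative
  supersolution lies the minimal solution, by a Knaster-Tarski argument
  (\<open>minimal_solution_le_supersolution\<close>), so \<open>x\<close> is not minimal.

  Conversely let \<open>\<rho>(P) \<le> 1\<close>, let \<open>m\<close> be the minimal solution, and let \<open>d = x - m \<ge> 0\<close>. Then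
  \<open>P d = d + b(d, d) \<ge> d\<close>. As \<open>x > 0\<close>, the matrix \<open>P\<close> has the zero pattern of \<open>R\<close> and is irreducible.
  Irreducibility spreads a strict inequality at one index to all of them, so if \<open>P d \<noteq> d\<close> there
  is \<open>w \<ge> 0\<close> with \<open>P w > w\<close> everywhere, forcing \<open>\<rho>(P) > 1\<close>
  (\<open>irreducible_spectral_radius_gt_one\<close>). Hence \<open>P d = d\<close> and \<open>b(d, d) = 0\<close>. If \<open>d\<close> were nonzero,
  irreducibility would make it strictly positive, so all coefficients of \<open>b\<close> would vanish, and
  \<open>d = P d = 0\<close> after all. So \<open>x = m\<close>.\<close>

section \<open>Nonnegative matrices and vectors\<close>

lemma mult_mat_vec_index_sum:
  assumes "A \<in> carrier_mat m n" "v \<in> carrier_vec n" "i < m"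
  shows "(A *\<^sub>v v) $ i = (\<Sum>j<n. A $$ (i, j) * v $ j)"
  using assms by (simp add: scalar_prod_def atLeast0LessThan)

lemma nonneg_matD:
  "0\<^sub>m m n \<le> A \<Longrightarrow> i < m \<Longrightarrow> j < n \<Longrightarrow> 0 \<le> (A $$ (i, j) :: real)"
  by (auto simp: less_eq_mat_def)

lemma nonneg_vecD:
  "0\<^sub>v n \<le> v \<Longrightarrow> i < n \<Longrightarrow> 0 \<le> (v $ i :: real)"
  by (auto simp: less_eq_vec_def)

lemma less_eq_vec_iff:
  "v \<in> carrier_vec n \<Longrightarrow> w \<in> carrier_vec n \<Longrightarrow> v \<le> w \<longleftrightarrow> (\<forall>i<n. v $ i \<le> w $ i)"
  by (auto simp: less_eq_vec_def)

lemma mult_mat_vec_mono: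
  fixes A :: "real mat"
  assumes A: "A \<in> carrier_mat m n" "0\<^sub>m m n \<le> A"
    and v: "v \<in> carrier_vec n" "w \<in> carrier_vec n" "v \<le> w"
  shows "A *\<^sub>v v \<le> A *\<^sub>v w"
  using A v
  by (auto simp: less_eq_vec_iff[where n = m] less_eq_vec_iff[where n = n] mult_mat_vec_index_sum
      intro!: sum_mono mult_left_mono nonneg_matD[OF A(2)] simp del: index_mult_mat_vec)

lemma pow_mat_nonneg:
  fixes A :: "real mat"
  assumes A: "A \<in> carrier_mat n n" "0\<^sub>m n n \<le> A"
  shows "0\<^sub>m n n \<le> A ^\<^sub>m k"
proof (induction k)
  case 0
  show ?case using A by (auto simp: less_eq_mat_def)
next
  case (Suc k)
  have P: "A ^\<^sub>m k \<in> carrier_mat n n" using A by simp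
  have "0 \<le> (A ^\<^sub>m k * A) $$ (i, j)" if ij: "i < n" "j < n" for i j
  proof -
    have "(A ^\<^sub>m k * A) $$ (i, j) = (\<Sum>l<n. (A ^\<^sub>m k) $$ (i, l) * A $$ (l, j))"
      using P A ij by (simp add: scalar_prod_def atLeast0LessThan)
    also have "0 \<le> \<dots>"
      using nonneg_matD[OF Suc] nonneg_matD[OF A(2)] ij
      by (intro sum_nonneg mult_nonneg_nonneg) auto
    finally show ?thesis .
  qed
  thus ?case using P A(1) by (simp add: less_eq_mat_def)
qed

section \<open>The spectral radius of a nonnegative matrix\<close>

text \<open>The maximum defining the spectral radius is attained, as the spectrum is finite and nonempty.\<close>

lemma ex_eigenvector_spectral_radius:
  assumes C: "C \<in> carrier_mat n n" and n: "0 < n"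
  obtains w \<mu> where "eigenvector C w \<mu>" "cmod \<mu> = spectral_radius C"
  using spectral_radius_mem_max(1)[OF C n] by (auto simp: spectrum_def eigenvalue_def)

lemma spectral_radius_nonneg:
  assumes "C \<in> carrier_mat n n" "0 < n"
  shows "0 \<le> spectral_radius C"
  by (rule ex_eigenvector_spectral_radius[OF assms]) (metis norm_ge_zero)

text \<open>If \<open>A w = \<mu> w\<close> with \<open>\<bar>\<mu>\<bar> = \<rho>(A)\<close>, the triangle inequality gives
  \<open>\<rho>(A) \<bar>w\<bar> = \<bar>A w\<bar> \<le> A \<bar>w\<bar>\<close>, with moduli taken entrywise.\<close>

lemma ex_nonneg_superinvariant_vec:
  fixes A :: "real mat"
  assumes A: "A \<in> carrier_mat n n" "0\<^sub>m n n \<le> A" and n: "0 < n"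
  shows "\<exists>v \<in> carrier_vec n. 0\<^sub>v n \<le> v \<and> v \<noteq> 0\<^sub>v n \<and>
           spectral_radius (map_mat complex_of_real A) \<cdot>\<^sub>v v \<le> A *\<^sub>v v"
proof -
  let ?C = "map_mat complex_of_real A"
  have C: "?C \<in> carrier_mat n n" using A by simp
  obtain w l where ev: "eigenvector ?C w l" and l: "cmod l = spectral_radius ?C"
    using ex_eigenvector_spectral_radius[OF C n] by blast
  have w: "w \<in> carrier_vec n" "w \<noteq> 0\<^sub>v n" "?C *\<^sub>v w = l \<cdot>\<^sub>v w"
    using ev C by (auto simp: eigenvector_def)
  define v where "v = map_vec cmod w"
  have v: "v \<in> carrier_vec n" using w by (simp add: v_def)
  have "0\<^sub>v n \<le> v" using w by (auto simp: v_def less_eq_vec_def)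
  moreover have "v \<noteq> 0\<^sub>v n"
  proof
    assume "v = 0\<^sub>v n"
    hence "v $ i = 0" if "i < n" for i using that by simp
    hence "w = 0\<^sub>v n" using w(1) by (intro eq_vecI) (auto simp: v_def)
    thus False using w(2) by simp
  qed
  moreover have "cmod l \<cdot>\<^sub>v v \<le> A *\<^sub>v v"
  proof -
    have "cmod l * v $ i \<le> (A *\<^sub>v v) $ i" if i: "i < n" for i
    proof -
      have "cmod l * v $ i = cmod ((?C *\<^sub>v w) $ i)"
        using i w by (simp add: v_def norm_mult)
      also have "\<dots> = cmod (\<Sum>j<n. of_real (A $$ (i, j)) * w $ j)"
        using i A w(1) by (simp add: scalar_prod_def atLeast0LessThan)
      also have "\<dots> \<le> (\<Sum>j<n. A $$ (i, j) * v $ j)"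
        using i w(1) nonneg_matD[OF A(2)]
        by (intro sum_norm_le) (simp add: v_def norm_mult)
      finally show ?thesis using mult_mat_vec_index_sum[OF A(1) v i] by simp
    qed
    thus ?thesis using v A by (simp add: less_eq_vec_def)
  qed
  ultimately show ?thesis using v l by auto
qed

lemma spectral_radius_scaled_less_one:
  fixes A :: "real mat"
  assumes A: "A \<in> carrier_mat n n" and n: "0 < n"
    and t: "spectral_radius (map_mat complex_of_real A) < t"
  shows "spectral_radius (map_mat complex_of_real ((1 / t) \<cdot>\<^sub>m A)) < 1"
proof -
  let ?C = "map_mat complex_of_real A"
  let ?D = "map_mat complex_of_real ((1 / t) \<cdot>\<^sub>m A)"
  have C: "?C \<in> carrier_mat n n" and D: "?D \<in> carrier_mat n n" using A by auto
  have t0: "0 < t" using spectral_radius_nonneg[OF C n] t by linarith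
  obtain w l where ev: "eigenvector ?D w l" and l: "cmod l = spectral_radius ?D"
    using ex_eigenvector_spectral_radius[OF D n] by blast
  have w: "w \<in> carrier_vec n" "w \<noteq> 0\<^sub>v n" "?D *\<^sub>v w = l \<cdot>\<^sub>v w"
    using ev D by (auto simp: eigenvector_def)
  have CD: "?C = of_real t \<cdot>\<^sub>m ?D" using t0 by (intro eq_matI) auto
  have "?C *\<^sub>v w = of_real t \<cdot>\<^sub>v (?D *\<^sub>v w)"
    unfolding CD using D w(1)
    by (intro eq_vecI) (auto simp: scalar_prod_def sum_distrib_left mult.assoc intro!: sum.cong)
  hence "eigenvector ?C w (of_real t * l)"
    using w C by (simp add: eigenvector_def smult_smult_assoc)
  hence "cmod (of_real t * l) \<le> spectral_radius ?C"
    by (intro spectral_radius_mem_max(2)[OF C n] imageI) (auto simp: spectrum_def eigenvalue_def)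
  hence "t * cmod l \<le> spectral_radius ?C" using t0 by (simp add: norm_mult)
  hence "t * cmod l < t * 1" using t by linarith
  hence "cmod l < 1" by (rule mult_left_less_imp_less) (use t0 in simp)
  thus ?thesis using l by simp
qed

text \<open>If \<open>\<rho>(A) < t < c\<close>, the powers of \<open>A / t\<close> are bounded, because \<open>\<rho>(A / t) < 1\<close>. But applied to
  \<open>v\<close> they dominate \<open>(c / t)\<^sup>k v\<close>, which is unbounded.\<close>

lemma superinvariant_le_spectral_radius:
  fixes A :: "real mat"
  assumes A: "A \<in> carrier_mat n n" "0\<^sub>m n n \<le> A"
    and v: "v \<in> carrier_vec n" "0\<^sub>v n \<le> v" "v \<noteq> 0\<^sub>v n"
    and c: "c \<cdot>\<^sub>v v \<le> A *\<^sub>v v"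
  shows "c \<le> spectral_radius (map_mat complex_of_real A)"
proof (rule ccontr)
  assume "\<not> ?thesis"
  then obtain t where t: "spectral_radius (map_mat complex_of_real A) < t" "t < c"
    using dense[of "spectral_radius (map_mat complex_of_real A)" c] by auto
  obtain i where i: "i < n" "0 < v $ i"
  proof -
    have "\<exists>i<n. v $ i \<noteq> 0"
    proof (rule ccontr)
      assume "\<not> ?thesis"
      hence "v = 0\<^sub>v n" using v(1) by (intro eq_vecI) auto
      thus False using v(3) by simp
    qed
    then obtain i where "i < n" "v $ i \<noteq> 0" by blast
    with nonneg_vecD[OF v(2), of i] that[of i] show ?thesis by simp
  qed
  hence n: "0 < n" by simp
  have t0: "0 < t"
    using spectral_radius_nonneg[of "map_mat complex_of_real A" n] A n t by simp
  define D where "D = (1 / t) \<cdot>\<^sub>m A"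
  have D: "D \<in> carrier_mat n n" "0\<^sub>m n n \<le> D"
    using A t0 by (auto simp: D_def less_eq_mat_def)
  define q where "q = c / t"
  have q: "1 < q" using t t0 by (simp add: q_def)
  have Dv: "q \<cdot>\<^sub>v v \<le> D *\<^sub>v v"
  proof -
    have "q * v $ j \<le> (D *\<^sub>v v) $ j" if j: "j < n" for j
    proof -
      have "c * v $ j \<le> (A *\<^sub>v v) $ j" using c j A v(1) by (simp add: less_eq_vec_def)
      moreover have "(D *\<^sub>v v) $ j = (1 / t) * (A *\<^sub>v v) $ j"
        using j A v(1) by (simp add: D_def scalar_prod_def sum_distrib_left)
      ultimately show ?thesis using t0 by (simp add: q_def divide_right_mono)
    qed
    thus ?thesis using D v by (simp add: less_eq_vec_def)
  qed
  have pow: "q ^ k \<cdot>\<^sub>v v \<le> D ^\<^sub>m k *\<^sub>v v" for k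
  proof (induction k)
    case 0
    show ?case using v D by simp
  next
    case (Suc k)
    have P: "D ^\<^sub>m k \<in> carrier_mat n n" using D by simp
    have "q ^ Suc k \<cdot>\<^sub>v v = q \<cdot>\<^sub>v (q ^ k \<cdot>\<^sub>v v)" by (simp add: smult_smult_assoc)
    also have "\<dots> \<le> q \<cdot>\<^sub>v (D ^\<^sub>m k *\<^sub>v v)"
      using Suc q P v by (auto simp: less_eq_vec_def)
    also have "\<dots> = D ^\<^sub>m k *\<^sub>v (q \<cdot>\<^sub>v v)" using mult_mat_vec[OF P v(1)] by simp
    also have "\<dots> \<le> D ^\<^sub>m k *\<^sub>v (D *\<^sub>v v)"
      using P v D Dv pow_mat_nonneg[OF D] by (intro mult_mat_vec_mono[of _ n n]) auto
    also have "\<dots> = D ^\<^sub>m Suc k *\<^sub>v v" using P D v by (simp add: assoc_mult_mat_vec[of _ n n _ n])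
    finally show ?case .
  qed
  have "spectral_radius (map_mat complex_of_real D) < 1"
    unfolding D_def using A n t(1) by (intro spectral_radius_scaled_less_one)
  hence "\<exists>K. \<forall>k. norm_bound (map_mat complex_of_real D ^\<^sub>m k) K"
    using D by (intro spectral_radius_jnf_norm_bound_less_1_upper_triangular[of _ n]) simp
  then obtain K where K: "\<And>k. norm_bound (map_mat complex_of_real D ^\<^sub>m k) K" by blast
  have bound: "(D ^\<^sub>m k) $$ (i, j) \<le> K" if j: "j < n" for j k
  proof -
    have "map_mat complex_of_real (D ^\<^sub>m k) = map_mat complex_of_real D ^\<^sub>m k"
      by (rule of_real_hom.mat_hom_pow[OF D(1)])
    hence "norm_bound (map_mat complex_of_real (D ^\<^sub>m k)) K"
      using K[of k] by (simp only:)
    moreover have P: "D ^\<^sub>m k \<in> carrier_mat n n" using D by simp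
    ultimately have "cmod (map_mat complex_of_real (D ^\<^sub>m k) $$ (i, j)) \<le> K"
      using i(1) j carrier_matD[OF P] unfolding norm_bound_def index_map_mat by (metis (no_types))
    thus ?thesis using i(1) j carrier_matD[OF P] by (simp del: pow_mat_dim)
  qed
  have q_le: "q ^ k \<le> K * (\<Sum>j<n. v $ j) / v $ i" for k
  proof -
    have P: "D ^\<^sub>m k \<in> carrier_mat n n" using D by simp
    have "q ^ k * v $ i \<le> (D ^\<^sub>m k *\<^sub>v v) $ i"
      using pow[of k] i(1) P v by (simp add: less_eq_vec_def del: index_mult_mat_vec)
    also have "\<dots> \<le> (\<Sum>j<n. K * v $ j)"
      unfolding mult_mat_vec_index_sum[OF P v(1) i(1)]
      using bound nonneg_vecD[OF v(2)] by (intro sum_mono mult_right_mono) auto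
    finally show ?thesis using i(2) by (simp add: sum_distrib_left field_simps)
  qed
  obtain k where "K * (\<Sum>j<n. v $ j) / v $ i < q ^ k" using real_arch_pow[OF q] by blast
  with q_le[of k] show False by linarith
qed

text \<open>In \<open>I - A = s I - B\<close> one has \<open>B = (s - 1) I + A\<close>. The vector \<open>v\<close> with \<open>\<rho>(A) v \<le> A v\<close> therefore
  satisfies \<open>(s - 1 + \<rho>(A)) v \<le> B v\<close>, whence \<open>s - 1 + \<rho>(A) \<le> \<rho>(B) \<le> s\<close>.\<close>

lemma M_matrix_one_minus_iff:
  assumes A: "A \<in> carrier_mat n n" "0\<^sub>m n n \<le> A" and n: "0 < n"
  shows "M_matrix n (1\<^sub>m n - A) \<longleftrightarrow> spectral_radius (map_mat complex_of_real A) \<le> 1"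
proof
  assume r: "spectral_radius (map_mat complex_of_real A) \<le> 1"
  have eq: "1\<^sub>m n - A = 1 \<cdot>\<^sub>m 1\<^sub>m n - A" using A by (intro eq_matI) auto
  show "M_matrix n (1\<^sub>m n - A)"
    unfolding M_matrix_def
    by (rule exI[where x = 1], rule exI[where x = A]) (intro conjI A eq r)
next
  assume "M_matrix n (1\<^sub>m n - A)"
  then obtain s B where B: "B \<in> carrier_mat n n" "0\<^sub>m n n \<le> B"
    and eq: "1\<^sub>m n - A = s \<cdot>\<^sub>m 1\<^sub>m n - B"
    and s: "spectral_radius (map_mat complex_of_real B) \<le> s"
    unfolding M_matrix_def by blast
  define r where "r = spectral_radius (map_mat complex_of_real A)"
  obtain v where v: "v \<in> carrier_vec n" "0\<^sub>v n \<le> v" "v \<noteq> 0\<^sub>v n" and Av: "r \<cdot>\<^sub>v v \<le> A *\<^sub>v v"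
    using ex_nonneg_superinvariant_vec[OF A n] by (auto simp: r_def)
  have B_eq: "B = (s - 1) \<cdot>\<^sub>m 1\<^sub>m n + A"
  proof (rule eq_matI)
    fix i j assume "i < dim_row ((s - 1) \<cdot>\<^sub>m 1\<^sub>m n + A)" "j < dim_col ((s - 1) \<cdot>\<^sub>m 1\<^sub>m n + A)"
    hence ij: "i < n" "j < n" using A by auto
    have "(1\<^sub>m n - A) $$ (i, j) = (s \<cdot>\<^sub>m 1\<^sub>m n - B) $$ (i, j)" using eq by simp
    thus "B $$ (i, j) = ((s - 1) \<cdot>\<^sub>m 1\<^sub>m n + A) $$ (i, j)"
      using ij A B by (auto split: if_splits)
  qed (use A B in auto)
  have Bv: "B *\<^sub>v v = (s - 1) \<cdot>\<^sub>v v + A *\<^sub>v v"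
  proof -
    have "((s - 1) \<cdot>\<^sub>m 1\<^sub>m n) *\<^sub>v v = (s - 1) \<cdot>\<^sub>v (1\<^sub>m n *\<^sub>v v)"
      using v by (intro eq_vecI) auto
    thus ?thesis using A v by (simp add: B_eq add_mult_distrib_mat_vec[of _ n n])
  qed
  have "(s - 1 + r) \<cdot>\<^sub>v v \<le> B *\<^sub>v v"
    using Av A v by (auto simp: Bv less_eq_vec_def algebra_simps)
  hence "s - 1 + r \<le> s" using superinvariant_le_spectral_radius[OF B v] s by fastforce
  thus "r \<le> 1" by simp
qed

section \<open>Irreducible nonnegative matrices\<close>

text \<open>The index set \<open>I\<close> on which \<open>v\<close> vanishes has no nonzero entry of \<open>A\<close> leading out of it: for
  \<open>i \<in> I\<close> the nonnegative terms of \<open>(A v)\<^sub>i \<le> c v\<^sub>i = 0\<close> all vanish.\<close>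

lemma irreducible_subinvariant_pos:
  assumes irr: "irreducible_matrix n A" and A: "0\<^sub>m n n \<le> A"
    and v: "v \<in> carrier_vec n" "0\<^sub>v n \<le> v" "v \<noteq> 0\<^sub>v n"
    and Av: "A *\<^sub>v v \<le> c \<cdot>\<^sub>v v"
    and i: "i < n"
  shows "0 < v $ i"
proof -
  have Ac: "A \<in> carrier_mat n n" using irr by (simp add: irreducible_matrix_def)
  define I where "I = {i \<in> {..<n}. v $ i = 0}"
  have "A $$ (i, j) = 0" if i: "i \<in> I" and j: "j \<in> {..<n} - I" for i j
  proof -
    have "(\<Sum>j<n. A $$ (i, j) * v $ j) \<le> c * v $ i"
      using Av i v Ac mult_mat_vec_index_sum[OF Ac v(1), of i]
      by (auto simp: less_eq_vec_def I_def simp del: index_mult_mat_vec)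
    hence "(\<Sum>j<n. A $$ (i, j) * v $ j) = 0"
      using i nonneg_matD[OF A] nonneg_vecD[OF v(2)]
      by (intro antisym sum_nonneg) (auto simp: I_def)
    hence "A $$ (i, j) * v $ j = 0"
      using i j nonneg_matD[OF A] nonneg_vecD[OF v(2)]
      by (intro sum_nonneg_0[of "{..<n}" "\<lambda>j. A $$ (i, j) * v $ j"]) (auto simp: I_def)
    thus ?thesis using j by (simp add: I_def)
  qed
  moreover have "I \<noteq> {..<n}"
  proof
    assume "I = {..<n}"
    hence "v = 0\<^sub>v n" using v(1) by (intro eq_vecI) (auto simp: I_def)
    thus False using v(3) by simp
  qed
  moreover have "I \<subseteq> {..<n}" by (auto simp: I_def)
  ultimately have "I = {}"
    using irr unfolding irreducible_matrix_def by blast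
  thus ?thesis using i nonneg_vecD[OF v(2) i] by (force simp: I_def)
qed

text \<open>Let \<open>I\<close> be the set of indices at which \<open>v \<le> A v\<close> is an equality. Irreducibility provides
  \<open>A\<^sub>i\<^sub>j > 0\<close> with \<open>i \<in> I\<close> and \<open>j \<notin> I\<close>. Raising \<open>v\<^sub>j\<close> a little keeps the inequality strict at \<open>j\<close>, makes it
  strict at \<open>i\<close>, and spoils it nowhere, so \<open>I\<close> shrinks; the argument is repeated until \<open>I\<close> is empty.\<close>

lemma irreducible_ex_strict_superinvariant:
  assumes irr: "irreducible_matrix n A" and A: "0\<^sub>m n n \<le> A"
    and v: "v \<in> carrier_vec n" "0\<^sub>v n \<le> v" "v \<le> A *\<^sub>v v" "v \<noteq> A *\<^sub>v v"
  shows "\<exists>w \<in> carrier_vec n. 0\<^sub>v n \<le> w \<and> (\<forall>i<n. w $ i < (A *\<^sub>v w) $ i)"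
  using v
proof (induction "card {i \<in> {..<n}. (A *\<^sub>v v) $ i = v $ i}" arbitrary: v rule: less_induct)
  case less
  note v = less.prems
  have Ac: "A \<in> carrier_mat n n" using irr by (simp add: irreducible_matrix_def)
  have le: "v $ i \<le> (A *\<^sub>v v) $ i" if "i < n" for i
    using v(1,3) that Ac by (simp add: less_eq_vec_def del: index_mult_mat_vec)
  define I where "I = {i \<in> {..<n}. (A *\<^sub>v v) $ i = v $ i}"
  show ?case
  proof (cases "I = {}")
    case True
    hence "\<forall>i<n. v $ i < (A *\<^sub>v v) $ i" using le by (force simp: I_def)
    thus ?thesis using v by blast
  next
    case False
    have "I \<noteq> {..<n}"
    proof
      assume "I = {..<n}"
      hence "(A *\<^sub>v v) $ i = v $ i" if "i < n" for i using that unfolding I_def by blast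
      hence "A *\<^sub>v v = v"
        using v(1) Ac by (intro eq_vecI) (simp_all del: index_mult_mat_vec)
      with v(4) show False by (rule notE[OF _ sym])
    qed
    hence "I \<subset> {..<n}" by (auto simp: I_def)
    then obtain i j where i: "i \<in> I" and j: "j \<in> {..<n} - I" and Aij: "A $$ (i, j) \<noteq> 0"
      using irr False unfolding irreducible_matrix_def by blast
    have ij: "i < n" "j < n" using i j by (auto simp: I_def)
    have Aij: "0 < A $$ (i, j)" using Aij nonneg_matD[OF A ij] by simp
    have gap: "v $ j < (A *\<^sub>v v) $ j" using le[OF ij(2)] j by (auto simp: I_def)
    \<comment> \<open>Half the gap at \<open>j\<close>, so that raising the left-hand side by \<open>\<epsilon>\<close> does not close it.\<close>
    define \<epsilon> where "\<epsilon> = ((A *\<^sub>v v) $ j - v $ j) / 2"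
    have \<epsilon>: "0 < \<epsilon>" using gap by (simp add: \<epsilon>_def)
    define w where "w = v + \<epsilon> \<cdot>\<^sub>v unit_vec n j"
    have w: "w \<in> carrier_vec n" using v by (simp add: w_def)
    have w_ix: "w $ k = v $ k + (if k = j then \<epsilon> else 0)" if "k < n" for k
      using that v ij by (simp add: w_def)
    have Aw: "(A *\<^sub>v w) $ k = (A *\<^sub>v v) $ k + A $$ (k, j) * \<epsilon>" if k: "k < n" for k
    proof -
      have "(A *\<^sub>v w) $ k = (\<Sum>l<n. A $$ (k, l) * v $ l + (if l = j then A $$ (k, l) * \<epsilon> else 0))"
        unfolding mult_mat_vec_index_sum[OF Ac w k]
        by (intro sum.cong) (auto simp: w_ix algebra_simps)
      also have "\<dots> = (A *\<^sub>v v) $ k + A $$ (k, j) * \<epsilon>"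
        unfolding mult_mat_vec_index_sum[OF Ac v(1) k] using ij by (simp add: sum.distrib)
      finally show ?thesis .
    qed
    have Ae: "0 \<le> A $$ (k, j) * \<epsilon>" if "k < n" for k
      using nonneg_matD[OF A that ij(2)] \<epsilon> by simp
    have strict_j: "w $ j < (A *\<^sub>v w) $ j"
      using Aw[OF ij(2)] w_ix[OF ij(2)] Ae[OF ij(2)] gap by (simp add: \<epsilon>_def field_simps)
    have ne: "i \<noteq> j" using i j by auto
    have strict_i: "w $ i < (A *\<^sub>v w) $ i"
      using Aw[OF ij(1)] w_ix[OF ij(1)] ne le[OF ij(1)] mult_pos_pos[OF Aij \<epsilon>] by simp
    have other: "w $ k - v $ k \<le> (A *\<^sub>v w) $ k - (A *\<^sub>v v) $ k" if "k < n" "k \<noteq> j" for k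
      using Aw[OF that(1)] w_ix[OF that(1)] Ae[OF that(1)] that(2) by simp
    have le': "w $ k \<le> (A *\<^sub>v w) $ k" if "k < n" for k
      using that other[OF that] le[OF that] strict_j by (cases "k = j") auto
    have "0\<^sub>v n \<le> w"
      using nonneg_vecD[OF v(2)] w_ix \<epsilon> w by (auto simp: less_eq_vec_def)
    moreover have "w \<le> A *\<^sub>v w"
      using le' w Ac by (simp add: less_eq_vec_def del: index_mult_mat_vec)
    moreover have "w \<noteq> A *\<^sub>v w" using strict_j by auto
    moreover have "{k \<in> {..<n}. (A *\<^sub>v w) $ k = w $ k} \<subset> I"
    proof
      show "{k \<in> {..<n}. (A *\<^sub>v w) $ k = w $ k} \<subseteq> I"
      proof
        fix k assume "k \<in> {k \<in> {..<n}. (A *\<^sub>v w) $ k = w $ k}"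
        hence k: "k < n" "(A *\<^sub>v w) $ k = w $ k" by auto
        hence "k \<noteq> j" using strict_j by auto
        thus "k \<in> I" using k other[OF k(1)] le[OF k(1)] by (simp add: I_def del: index_mult_mat_vec)
      qed
      show "{k \<in> {..<n}. (A *\<^sub>v w) $ k = w $ k} \<noteq> I" using i strict_i by auto
    qed
    hence "card {k \<in> {..<n}. (A *\<^sub>v w) $ k = w $ k} < card I"
      by (intro psubset_card_mono) (auto simp: I_def)
    ultimately show ?thesis using less.hyps[of w] w by (simp add: I_def)
  qed
qed

text \<open>A vector that is strictly increased at each of its finitely many indices is increased by a
  common factor \<open>c > 1\<close>, to which the bound by the spectral radius applies.\<close>

lemma irreducible_spectral_radius_gt_one:
  assumes irr: "irreducible_matrix n A" and A: "0\<^sub>m n n \<le> A"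
    and v: "v \<in> carrier_vec n" "0\<^sub>v n \<le> v" "v \<le> A *\<^sub>v v" "v \<noteq> A *\<^sub>v v"
  shows "1 < spectral_radius (map_mat complex_of_real A)"
proof -
  have Ac: "A \<in> carrier_mat n n" using irr by (simp add: irreducible_matrix_def)
  obtain w where w: "w \<in> carrier_vec n" "0\<^sub>v n \<le> w" and less: "\<And>i. i < n \<Longrightarrow> w $ i < (A *\<^sub>v w) $ i"
    using irreducible_ex_strict_superinvariant[OF assms] by auto
  have "\<forall>i\<in>{..<n}. \<forall>\<^sub>F c in at_right 1. c * w $ i < (A *\<^sub>v w) $ i"
  proof
    fix i assume i: "i \<in> {..<n}"
    have "((\<lambda>c. c * w $ i) \<longlongrightarrow> 1 * w $ i) (at_right 1)" by (intro tendsto_intros)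
    thus "\<forall>\<^sub>F c in at_right 1. c * w $ i < (A *\<^sub>v w) $ i"
      using less i by (intro order_tendstoD) (auto simp del: index_mult_mat_vec)
  qed
  hence "\<forall>\<^sub>F c in at_right 1. \<forall>i\<in>{..<n}. c * w $ i < (A *\<^sub>v w) $ i"
    by (intro eventually_ball_finite) auto
  moreover have "\<forall>\<^sub>F c in at_right 1. (1::real) < c" by (rule eventually_at_right_less)
  ultimately have "\<forall>\<^sub>F c in at_right 1. (1::real) < c \<and> (\<forall>i\<in>{..<n}. c * w $ i < (A *\<^sub>v w) $ i)"
    by eventually_elim auto
  then obtain c where c: "1 < c" "\<forall>i\<in>{..<n}. c * w $ i < (A *\<^sub>v w) $ i"
    using eventually_happens'[OF trivial_limit_at_right_real] by blast
  have "c \<cdot>\<^sub>v w \<le> A *\<^sub>v w"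
    using c(2) w(1) Ac by (auto simp: less_eq_vec_def less_imp_le simp del: index_mult_mat_vec)
  moreover have "w \<noteq> 0\<^sub>v n"
  proof
    assume "w = 0\<^sub>v n"
    moreover have "v \<noteq> A *\<^sub>v v" by (rule v(4))
    hence "0 < n" using v(1) Ac by (cases n) (auto intro: eq_vecI)
    ultimately show False using less[of 0] Ac by (simp add: scalar_prod_def)
  qed
  ultimately have "c \<le> spectral_radius (map_mat complex_of_real A)"
    using superinvariant_le_spectral_radius[OF Ac A w] by simp
  thus ?thesis using c by simp
qed

lemma irreducible_matrix_mono_support:
  assumes "irreducible_matrix n A" "B \<in> carrier_mat n n"
    and "\<And>i j. i < n \<Longrightarrow> j < n \<Longrightarrow> B $$ (i, j) = 0 \<Longrightarrow> A $$ (i, j) = 0"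
  shows "irreducible_matrix n B"
  unfolding irreducible_matrix_def
proof (intro conjI notI)
  assume "\<exists>I. I \<noteq> {} \<and> I \<subset> {..<n} \<and> (\<forall>i\<in>I. \<forall>j\<in>{..<n} - I. B $$ (i, j) = 0)"
  then obtain I where I: "I \<noteq> {}" "I \<subset> {..<n}" "\<forall>i\<in>I. \<forall>j\<in>{..<n} - I. B $$ (i, j) = 0"
    by blast
  hence "\<forall>i\<in>I. \<forall>j\<in>{..<n} - I. A $$ (i, j) = 0" using assms(3) by blast
  thus False using assms(1) I(1,2) unfolding irreducible_matrix_def by blast
qed (rule assms(2))

section \<open>The quadratic equation near a solution\<close>

text \<open>The derivative of \<open>x \<mapsto> b(x, x)\<close>. At \<open>x = e\<close> this is the matrix \<open>R\<close>.\<close>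

abbreviation bil_sym :: "nat \<Rightarrow> (nat \<Rightarrow> nat \<Rightarrow> nat \<Rightarrow> real) \<Rightarrow> real vec \<Rightarrow> real mat" where
  "bil_sym N b x \<equiv> bil_left N b x + bil_right N b x"

lemma bil_carrier [simp]: "bil N b x y \<in> carrier_vec N"
  by (simp add: bil_def)

lemma dim_bil [simp]: "dim_vec (bil N b x y) = N"
  by (simp add: bil_def)

lemma bil_index: "i < N \<Longrightarrow> bil N b x y $ i = (\<Sum>j<N. \<Sum>k<N. b i j k * (x $ j * y $ k))"
  by (simp add: bil_def mult.assoc)

lemma bil_sym_carrier [simp]: "bil_sym N b x \<in> carrier_mat N N"
  by (simp add: bil_left_def bil_right_def)

lemma bil_sym_index:
  assumes "i < N" "l < N"
  shows "bil_sym N b x $$ (i, l) = (\<Sum>j<N. (b i j l + b i l j) * x $ j)"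
proof -
  have "bil_right N b x \<in> carrier_mat N N" by (simp add: bil_right_def)
  hence "bil_sym N b x $$ (i, l) = bil_left N b x $$ (i, l) + bil_right N b x $$ (i, l)"
    using assms by simp
  thus ?thesis
    using assms by (simp add: bil_left_index bil_right_index sum.distrib distrib_right)
qed

lemma bil_sym_mult:
  assumes "v \<in> carrier_vec N"
  shows "bil_sym N b x *\<^sub>v v = bil N b x v + bil N b v x"
proof -
  have "bil_left N b x \<in> carrier_mat N N" "bil_right N b x \<in> carrier_mat N N"
    by (simp_all add: bil_left_def bil_right_def)
  thus ?thesis
    using assms by (simp add: add_mult_distrib_mat_vec[of _ N N] bil_left_mult bil_right_mult)
qed

lemma qve_jacobian_eq: "qve_jacobian N b x = 1\<^sub>m N - bil_sym N b x"
  by (intro eq_matI) (auto simp: qve_jacobian_def bil_left_def bil_right_def)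

text \<open>The second-order expansion of \<open>F\<close> at \<open>x\<close>, which is exact since \<open>F\<close> is quadratic; the constant
  term is \<open>F(x) = 0\<close>.\<close>

lemma qve_defect:
  assumes a: "a \<in> carrier_vec N" and x: "qve_solution N a b x" and d: "d \<in> carrier_vec N"
    and i: "i < N"
  shows "(x - d) $ i - (a + bil N b (x - d) (x - d)) $ i =
           (bil_sym N b x *\<^sub>v d) $ i - d $ i - bil N b d d $ i"
proof -
  have xc: "x \<in> carrier_vec N" and "x = a + bil N b x x"
    using x by (auto simp: qve_solution_def)
  hence "x $ i = a $ i + bil N b x x $ i" using i by (metis dim_bil index_add_vec(1))
  moreover have "bil N b (x - d) (x - d) $ i =
      bil N b x x $ i - (bil N b x d $ i + bil N b d x $ i) + bil N b d d $ i"
  proof -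
    have "bil N b (x - d) (x - d) $ i = (\<Sum>j<N. \<Sum>k<N.
        b i j k * (x $ j * x $ k) - (b i j k * (x $ j * d $ k) + b i j k * (d $ j * x $ k)) +
        b i j k * (d $ j * d $ k))"
      unfolding bil_index[OF i] using xc d
      by (intro sum.cong refl) (simp add: algebra_simps)
    thus ?thesis unfolding bil_index[OF i] by (simp add: sum.distrib sum_subtractf)
  qed
  ultimately show ?thesis
    using i a xc d by (simp add: bil_sym_mult)
qed

section \<open>Minimality and the spectral radius\<close>

locale nonneg_qve =
  fixes N :: nat and a :: "real vec" and b :: "nat \<Rightarrow> nat \<Rightarrow> nat \<Rightarrow> real"
  assumes a_carrier: "a \<in> carrier_vec N" and a_nonneg: "0\<^sub>v N \<le> a"
    and b_nonneg: "\<And>i j k. i < N \<Longrightarrow> j < N \<Longrightarrow> k < N \<Longrightarrow> 0 \<le> b i j k"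
begin

lemma bil_mono:
  assumes "0\<^sub>v N \<le> x" "x \<le> x'" "0\<^sub>v N \<le> y" "y \<le> y'"
  shows "bil N b x y \<le> bil N b x' y'"
proof -
  have "x $ j * y $ k \<le> x' $ j * y' $ k" if "j < N" "k < N" for j k
  proof (rule mult_mono)
    show "x $ j \<le> x' $ j" "y $ k \<le> y' $ k"
      using assms that by (auto simp: less_eq_vec_def)
    show "0 \<le> x' $ j" "0 \<le> y $ k"
      using that nonneg_vecD[OF order_trans[OF assms(1,2)]] nonneg_vecD[OF assms(3)] by auto
  qed
  thus ?thesis
    by (auto simp: less_eq_vec_def bil_index intro!: sum_mono mult_left_mono b_nonneg)
qed

lemma bil_nonneg:
  assumes "0\<^sub>v N \<le> x" "0\<^sub>v N \<le> y"
  shows "0\<^sub>v N \<le> bil N b x y"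
  using assms
  by (auto simp: less_eq_vec_def bil_index intro!: sum_nonneg mult_nonneg_nonneg b_nonneg)

lemma bil_sym_nonneg:
  assumes "0\<^sub>v N \<le> x"
  shows "0\<^sub>m N N \<le> bil_sym N b x"
  unfolding less_eq_mat_def
proof (intro conjI allI impI)
  fix i j assume "i < dim_row (bil_sym N b x)" "j < dim_col (bil_sym N b x)"
  hence ij: "i < N" "j < N" using bil_sym_carrier[of N b x] by (metis carrier_matD)+
  hence "0 \<le> bil_sym N b x $$ (i, j)"
    using nonneg_vecD[OF assms] b_nonneg unfolding bil_sym_index[OF ij]
    by (intro sum_nonneg mult_nonneg_nonneg add_nonneg_nonneg) auto
  thus "0\<^sub>m N N $$ (i, j) \<le> bil_sym N b x $$ (i, j)" using ij by simp
qed (simp_all add: bil_left_def bil_right_def)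

text \<open>The Knaster-Tarski argument for the monotone map \<open>G(z) = a + b(z, z)\<close>: the componentwise infimum
  \<open>m\<close> of all nonnegative supersolutions satisfies \<open>G(m) \<le> m\<close> by monotonicity. Then \<open>G(m)\<close> is itself a
  supersolution, so \<open>m \<le> G(m)\<close>. All solutions are supersolutions, so \<open>m\<close> is minimal among them.\<close>

lemma minimal_solution_le_supersolution:
  assumes y: "y \<in> carrier_vec N" "0\<^sub>v N \<le> y" "a + bil N b y y \<le> y"
  shows "\<exists>m \<le> y. minimal_nonneg_solution N a b m"
proof -
  define S where "S = {z \<in> carrier_vec N. 0\<^sub>v N \<le> z \<and> a + bil N b z z \<le> z}"
  have yS: "y \<in> S" using y by (simp add: S_def)
  define m where "m = vec N (\<lambda>i. INF z\<in>S. z $ i)"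
  have m: "m \<in> carrier_vec N" by (simp add: m_def)
  have greatest: "w \<le> m" if w: "w \<in> carrier_vec N" "\<And>z. z \<in> S \<Longrightarrow> w \<le> z" for w
  proof -
    have "w $ i \<le> (INF z\<in>S. z $ i)" if "i < N" for i
    proof (rule cINF_greatest)
      show "S \<noteq> {}" using yS by auto
      show "w $ i \<le> z $ i" if "z \<in> S" for z
        using w(1) w(2)[OF that] that \<open>i < N\<close> by (auto simp: S_def less_eq_vec_def)
    qed
    thus ?thesis using w(1) by (simp add: less_eq_vec_def m_def)
  qed
  have lower: "m \<le> z" if z: "z \<in> S" for z
  proof -
    have "(INF z\<in>S. z $ i) \<le> z $ i" if "i < N" for i
    proof (rule cINF_lower[OF _ z])
      show "bdd_below ((\<lambda>z. z $ i) ` S)"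
        using \<open>i < N\<close> by (intro bdd_belowI2[of _ 0] nonneg_vecD[of N]) (auto simp: S_def)
    qed
    thus ?thesis using z by (simp add: less_eq_vec_def m_def S_def)
  qed
  have m0: "0\<^sub>v N \<le> m" by (rule greatest) (auto simp: S_def)
  define m' where "m' = a + bil N b m m"
  have m': "m' \<in> carrier_vec N" "0\<^sub>v N \<le> m'"
    using a_carrier a_nonneg bil_nonneg[OF m0 m0] by (auto simp: m'_def less_eq_vec_def)
  have "m' \<le> m"
  proof (rule greatest[OF m'(1)])
    fix z assume z: "z \<in> S"
    have "m' \<le> a + bil N b z z"
      using bil_mono[OF m0 lower[OF z] m0 lower[OF z]] a_carrier
      by (auto simp: m'_def less_eq_vec_def)
    also have "\<dots> \<le> z" using z by (simp add: S_def)
    finally show "m' \<le> z" .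
  qed
  moreover have "m \<le> m'"
  proof (rule lower)
    have "a + bil N b m' m' \<le> m'"
      using bil_mono[OF m'(2) \<open>m' \<le> m\<close> m'(2) \<open>m' \<le> m\<close>] a_carrier
      by (auto simp: m'_def less_eq_vec_def)
    thus "m' \<in> S" using m' by (simp add: S_def)
  qed
  ultimately have "qve_solution N a b m"
    using m unfolding qve_solution_def m'_def by (simp add: order.antisym)
  moreover have "m \<le> z" if "qve_solution N a b z" "0\<^sub>v N \<le> z" for z
    using that by (intro lower) (auto simp: S_def qve_solution_def)
  ultimately show ?thesis
    using lower[OF yS] m0 by (auto simp: minimal_nonneg_solution_def)
qed

text \<open>If \<open>r = \<rho>(P) > 1\<close> and \<open>P v \<ge> r v\<close>, then \<open>x - t v\<close> is a supersolution for small \<open>t > 0\<close>, which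
  requires \<open>P v - v \<ge> t b(v, v)\<close>. At an index with \<open>v\<^sub>i > 0\<close> the left-hand side is positive, and
  smallness of \<open>t\<close> suffices. At an index with \<open>v\<^sub>i = 0\<close> it may be zero; there the
  comparison \<open>t b(v, v) = b(t v, v) \<le> b(x, v) \<le> P v\<close> is used, valid as soon as \<open>t v \<le> x\<close>.\<close>

lemma minimal_imp_spectral_radius_le_one:
  assumes N: "0 < N" and x: "minimal_nonneg_solution N a b x"
    and pos: "\<And>i. i < N \<Longrightarrow> 0 < x $ i"
  shows "spectral_radius (map_mat complex_of_real (bil_sym N b x)) \<le> 1"
proof (rule ccontr)
  let ?P = "bil_sym N b x"
  define r where "r = spectral_radius (map_mat complex_of_real ?P)"
  assume "\<not> spectral_radius (map_mat complex_of_real ?P) \<le> 1"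
  hence r: "1 < r" by (simp add: r_def)
  have sol: "qve_solution N a b x" and x0: "0\<^sub>v N \<le> x" and xc: "x \<in> carrier_vec N"
    using x by (auto simp: minimal_nonneg_solution_def qve_solution_def)
  obtain v where v: "v \<in> carrier_vec N" "0\<^sub>v N \<le> v" "v \<noteq> 0\<^sub>v N" and rv: "r \<cdot>\<^sub>v v \<le> ?P *\<^sub>v v"
    using ex_nonneg_superinvariant_vec[OF bil_sym_carrier bil_sym_nonneg[OF x0] N]
    by (auto simp: r_def)
  have rv: "r * v $ i \<le> (?P *\<^sub>v v) $ i" if "i < N" for i
    using rv that v(1) bil_sym_carrier[of N b x]
    by (auto simp: less_eq_vec_def simp del: bil_sym_carrier index_mult_mat_vec)
  have small: "\<forall>\<^sub>F t in at_right 0. t * v $ i < x $ i \<and>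
      (0 < v $ i \<longrightarrow> t * bil N b v v $ i < (?P *\<^sub>v v) $ i - v $ i)" if i: "i < N" for i
  proof (intro eventually_conj)
    have "((\<lambda>t. t * v $ i) \<longlongrightarrow> 0 * v $ i) (at_right 0)" by (intro tendsto_intros)
    thus "\<forall>\<^sub>F t in at_right 0. t * v $ i < x $ i"
      using pos[OF i] by (intro order_tendstoD) auto
    show "\<forall>\<^sub>F t in at_right 0. 0 < v $ i \<longrightarrow> t * bil N b v v $ i < (?P *\<^sub>v v) $ i - v $ i"
    proof (cases "0 < v $ i")
      case True
      hence "v $ i < r * v $ i" using r by simp
      hence "0 * bil N b v v $ i < (?P *\<^sub>v v) $ i - v $ i" using rv[OF i] by linarith
      moreover have "((\<lambda>t. t * bil N b v v $ i) \<longlongrightarrow> 0 * bil N b v v $ i) (at_right 0)"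
        by (intro tendsto_intros)
      ultimately have "\<forall>\<^sub>F t in at_right 0. t * bil N b v v $ i < (?P *\<^sub>v v) $ i - v $ i"
        by (intro order_tendstoD(2))
      thus ?thesis by eventually_elim auto
    qed simp
  qed
  have "\<forall>\<^sub>F t in at_right 0. \<forall>i\<in>{..<N}. t * v $ i < x $ i \<and>
      (0 < v $ i \<longrightarrow> t * bil N b v v $ i < (?P *\<^sub>v v) $ i - v $ i)"
    using small by (intro eventually_ball_finite) auto
  moreover have "\<forall>\<^sub>F t in at_right 0. (0::real) < t" by (rule eventually_at_right_less)
  ultimately have "\<forall>\<^sub>F t in at_right 0. (0::real) < t \<and> (\<forall>i\<in>{..<N}. t * v $ i < x $ i \<and>
      (0 < v $ i \<longrightarrow> t * bil N b v v $ i < (?P *\<^sub>v v) $ i - v $ i))"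
    by eventually_elim auto
  then obtain t where t: "0 < t" "\<And>i. i < N \<Longrightarrow> t * v $ i < x $ i"
    "\<And>i. i < N \<Longrightarrow> 0 < v $ i \<Longrightarrow> t * bil N b v v $ i < (?P *\<^sub>v v) $ i - v $ i"
    using eventually_happens'[OF trivial_limit_at_right_real] by (metis (no_types, lifting) lessThan_iff)
  define d where "d = t \<cdot>\<^sub>v v"
  have d: "d \<in> carrier_vec N" "0\<^sub>v N \<le> d" "d \<le> x"
    using v t xc by (auto simp: d_def less_eq_vec_def less_imp_le)
  have bil_dd: "bil N b d d $ i = t * bil N b d v $ i" if i: "i < N" for i
    using i v by (simp add: bil_index d_def sum_distrib_left mult_ac)
  have bil_dv: "bil N b d v $ i = t * bil N b v v $ i" if i: "i < N" for i
    using i v by (simp add: bil_index d_def sum_distrib_left mult_ac)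
  have Pd: "(?P *\<^sub>v d) $ i = t * (?P *\<^sub>v v) $ i" if i: "i < N" for i
    using i v mult_mat_vec[OF bil_sym_carrier v(1), of b x t]
    by (simp add: d_def bil_sym_mult)
  have key: "v $ i + bil N b d v $ i \<le> (?P *\<^sub>v v) $ i" if i: "i < N" for i
  proof (cases "0 < v $ i")
    case True
    thus ?thesis using t(3)[OF i] bil_dv[OF i] by simp
  next
    case False
    hence "v $ i = 0" using nonneg_vecD[OF v(2) i] by simp
    moreover have "bil N b d v $ i \<le> bil N b x v $ i"
      using bil_mono[OF d(2,3) v(2) order_refl] i by (simp add: less_eq_vec_def)
    moreover have "0 \<le> bil N b v x $ i" by (rule nonneg_vecD[OF bil_nonneg[OF v(2) x0] i])
    ultimately show ?thesis using i v(1) by (simp add: bil_sym_mult)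
  qed
  have "(a + bil N b (x - d) (x - d)) $ i \<le> (x - d) $ i" if i: "i < N" for i
  proof -
    have "0 \<le> t * ((?P *\<^sub>v v) $ i - v $ i - bil N b d v $ i)" using key[OF i] t(1) by simp
    also have "\<dots> = (?P *\<^sub>v d) $ i - d $ i - bil N b d d $ i"
      using Pd[OF i] bil_dd[OF i] i v(1) by (simp add: d_def algebra_simps)
    also have "\<dots> = (x - d) $ i - (a + bil N b (x - d) (x - d)) $ i"
      by (rule qve_defect[OF a_carrier sol d(1) i, symmetric])
    finally show ?thesis by simp
  qed
  hence "a + bil N b (x - d) (x - d) \<le> x - d"
    using d xc a_carrier by (simp add: less_eq_vec_def)
  moreover have "x - d \<in> carrier_vec N" "0\<^sub>v N \<le> x - d"
    using d xc by (auto simp: less_eq_vec_def)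
  ultimately obtain m where "m \<le> x - d" "minimal_nonneg_solution N a b m"
    using minimal_solution_le_supersolution by blast
  hence "x \<le> x - d" using x unfolding minimal_nonneg_solution_def by (meson order_trans)
  hence "v $ i \<le> 0" if "i < N" for i
    using that d(1) xc v(1) t(1) by (auto simp: less_eq_vec_def d_def mult_le_0_iff)
  hence "v = 0\<^sub>v N"
    using v(1) nonneg_vecD[OF v(2)] by (intro eq_vecI) (auto simp: order.antisym)
  thus False using v(3) by simp
qed

text \<open>The difference \<open>d\<close> from the minimal solution satisfies \<open>P d = d + b(d, d)\<close>. With \<open>\<rho>(P) \<le> 1\<close> and
  irreducibility the quadratic term must vanish, but for \<open>d > 0\<close> this is possible only for \<open>b = 0\<close>.\<close>

lemma spectral_radius_le_one_imp_minimal: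
  assumes x: "qve_solution N a b x" "0\<^sub>v N \<le> x"
    and irr: "irreducible_matrix N (bil_sym N b x)"
    and r: "spectral_radius (map_mat complex_of_real (bil_sym N b x)) \<le> 1"
  shows "minimal_nonneg_solution N a b x"
proof -
  let ?P = "bil_sym N b x"
  have xc: "x \<in> carrier_vec N" and "a + bil N b x x = x" using x by (auto simp: qve_solution_def)
  then obtain m where mx: "m \<le> x" and m: "minimal_nonneg_solution N a b m"
    using minimal_solution_le_supersolution[of x] x(2) by auto
  have mc: "m \<in> carrier_vec N" and m_sol: "a + bil N b m m = m"
    using m by (auto simp: minimal_nonneg_solution_def qve_solution_def)
  define d where "d = x - m"
  have d: "d \<in> carrier_vec N" "0\<^sub>v N \<le> d" using xc mc mx by (auto simp: d_def less_eq_vec_def)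
  have P0: "0\<^sub>m N N \<le> ?P" by (rule bil_sym_nonneg[OF x(2)])
  have "x - d = m" using xc mc by (auto simp: d_def)
  hence Pd: "(?P *\<^sub>v d) $ i = d $ i + bil N b d d $ i" if "i < N" for i
    using qve_defect[OF a_carrier x(1) d(1) that] m_sol by simp
  have d_le: "d \<le> ?P *\<^sub>v d"
    using Pd nonneg_vecD[OF bil_nonneg[OF d(2) d(2)]] d(1)
    by (subst less_eq_vec_iff[of _ N]) (auto simp: bil_sym_mult)
  have "d = 0\<^sub>v N"
  proof (rule ccontr)
    assume d_ne: "d \<noteq> 0\<^sub>v N"
    have fix_d: "d = ?P *\<^sub>v d"
      using irreducible_spectral_radius_gt_one[OF irr P0 d d_le] r by linarith
    hence pos: "0 < d $ i" if "i < N" for i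
      using irreducible_subinvariant_pos[OF irr P0 d d_ne, of 1 i] that by simp
    have b0: "b i j k = 0" if i: "i < N" and jk: "j < N" "k < N" for i j k
    proof -
      have nn: "0 \<le> b i j k * (d $ j * d $ k)" if "j < N" "k < N" for j k
        using b_nonneg[OF i that] pos that by (simp add: less_imp_le)
      have "(\<Sum>j<N. \<Sum>k<N. b i j k * (d $ j * d $ k)) = 0"
        using Pd[OF i] fix_d bil_index[OF i, of b d d] by (metis add_cancel_left_right)
      hence "(\<Sum>k<N. b i j k * (d $ j * d $ k)) = 0"
        using nn jk
        by (intro sum_nonneg_0[of "{..<N}" "\<lambda>j. \<Sum>k<N. b i j k * (d $ j * d $ k)"])
          (auto intro!: sum_nonneg)
      hence "b i j k * (d $ j * d $ k) = 0"
        using nn jk by (intro sum_nonneg_0[of "{..<N}" "\<lambda>k. b i j k * (d $ j * d $ k)"]) auto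
      thus ?thesis using pos[OF jk(1)] pos[OF jk(2)] by simp
    qed
    have "d $ i = 0" if "i < N" for i
      using that arg_cong[OF fix_d, of "\<lambda>v. v $ i"] d(1) b0[OF that]
      by (simp add: bil_sym_mult bil_index)
    hence "d = 0\<^sub>v N" using d(1) by (intro eq_vecI) auto
    thus False using d_ne by simp
  qed
  hence "x = m" using \<open>x - d = m\<close> xc by auto
  thus ?thesis using m by simp
qed

end

text \<open>The entry \<open>(i, l)\<close> of the matrix is a combination of the coefficients \<open>b\<^sub>i\<^sub>j\<^sub>l + b\<^sub>i\<^sub>l\<^sub>j\<close> with the
  positive weights \<open>x\<^sub>j\<close>. If it vanishes, so do all these coefficients, hence also the entry for any
  other vector.\<close>

lemma irreducible_bil_sym_pos:
  assumes irr: "irreducible_matrix N (bil_sym N b y)"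
    and b: "\<And>i j k. i < N \<Longrightarrow> j < N \<Longrightarrow> k < N \<Longrightarrow> 0 \<le> b i j k"
    and x: "\<And>i. i < N \<Longrightarrow> 0 < x $ i"
  shows "irreducible_matrix N (bil_sym N b x)"
proof (rule irreducible_matrix_mono_support[OF irr bil_sym_carrier])
  fix i l assume il: "i < N" "l < N" and "bil_sym N b x $$ (i, l) = 0"
  hence "(\<Sum>j<N. (b i j l + b i l j) * x $ j) = 0" by (simp add: bil_sym_index)
  hence "(b i j l + b i l j) * x $ j = 0" if "j < N" for j
    using that il b x
    by (intro sum_nonneg_0[of "{..<N}" "\<lambda>j. (b i j l + b i l j) * x $ j"])
      (auto intro!: mult_nonneg_nonneg add_nonneg_nonneg simp: less_imp_le)
  hence "b i j l + b i l j = 0" if "j < N" for j using that x by fastforce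
  thus "bil_sym N b y $$ (i, l) = 0" using il by (simp add: bil_sym_index)
qed

theorem theorem2:
  fixes N :: nat and a x :: "real vec" and b :: "nat \<Rightarrow> nat \<Rightarrow> nat \<Rightarrow> real"
  assumes "0 < N"
    and "a \<in> carrier_vec N" and "0\<^sub>v N \<le> a"
    and "\<And>i j k. i < N \<Longrightarrow> j < N \<Longrightarrow> k < N \<Longrightarrow> 0 \<le> b i j k"
    and "ones_vec N = a + bil N b (ones_vec N) (ones_vec N)"
    and "qve_solution N a b x" and "\<And>i. i < N \<Longrightarrow> 0 < x $ i"
    and "irreducible_matrix N (bil_left N b (ones_vec N) + bil_right N b (ones_vec N))"
  shows "M_matrix N (qve_jacobian N b x) \<longleftrightarrow> minimal_nonneg_solution N a b x"
proof -
  interpret nonneg_qve N a b by unfold_locales fact+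
  have x0: "0\<^sub>v N \<le> x"
    using assms(6,7) by (auto simp: qve_solution_def less_eq_vec_def less_imp_le)
  have irr: "irreducible_matrix N (bil_sym N b x)"
    by (rule irreducible_bil_sym_pos[OF assms(8,4,7)])
  have "M_matrix N (qve_jacobian N b x) \<longleftrightarrow>
      spectral_radius (map_mat complex_of_real (bil_sym N b x)) \<le> 1"
    unfolding qve_jacobian_eq by (rule M_matrix_one_minus_iff[OF bil_sym_carrier bil_sym_nonneg[OF x0] assms(1)])
  also have "\<dots> \<longleftrightarrow> minimal_nonneg_solution N a b x"
    using minimal_imp_spectral_radius_le_one[OF assms(1) _ assms(7)]
      spectral_radius_le_one_imp_minimal[OF assms(6) x0 irr] by blast
  finally show ?thesis .
qed

end
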